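(* For $n,k\ge1$, \[ d(n,k)=\sum_{r=2}^k \sum_{\ell=1}^r \sum_{r_1+ \dots +r_{\ell}=r} \sum_{\substack{n_1< \cdots <n_{\ell} \\ r_1n_1+ \cdots +r_{\ell}n_{\ell}=n}} \sum_{\substack{k_1+ \cdots +k_{\ell}=k\\k_i \geq r_i}}\left( \binom{r}{r_1,r_2,\dots,r_{\ell}} \prod_{i=1}^\ell \sum_{k_{i_1}+ \cdots +k_{i_{r_i}}=k_i} \prod_{t=1}^{r_i}c(n_i,k_{i_t})\right), \] where all summation variables $r_i,n_i,k_i,k_{i_t}$ are positive integers and $\binom{r}{r_1,\dots,r_\ell}$ is the multinomial coefficient.
   Context: For a permutation $\pi$ of $[n]=\{1,\dots,n\}$ (one-line notation $[\pi(1),\dots,\pi(n)]$), the permutation graph $G_\pi$ has vertex set $[n]$ and an edge between $i<j$ iff $\pi^{-1}(i)>\pi^{-1}(j)$. The domination number is the minimum size of a set $D$ of vertices such that every vertex is in $D$ or adjacent to a vertex of $D$. $c(n,k)$ denotes the number of permutations $\pi\in S_n$ such that $G_\pi$ is connected and has domination number $k$, and $d(n,k)$ denotes the number of permutations $\pi\in S_n$ such that $G_\pi$ is disconnected and has domination number $k$. *)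

theory Defs
  imports "HOL-Combinatorics.Permutations" "Graph_Theory.Digraph_Component"
begin

(* Undirected graphs are represented as symmetric loop-free digraphs: the edge
   between i and j is the pair of arcs (i, j) and (j, i). *)
definition perm_graph :: "nat \<Rightarrow> (nat \<Rightarrow> nat) \<Rightarrow> nat pair_pre_digraph" where
  "perm_graph n p =
     \<lparr> pverts = {1..n},
       parcs = (let E = {(i, j). i \<in> {1..n} \<and> j \<in> {1..n} \<and> i < j \<and> inv p i > inv p j}
                in E \<union> E\<inverse>) \<rparr>"

lemma pair_graph_perm_graph: "pair_graph (perm_graph n p)"
proof
  show "finite (parcs (perm_graph n p))"
    by (rule finite_subset[of _ "{1..n} \<times> {1..n}"]) (auto simp: perm_graph_def Let_def)
  show "symmetric (with_proj (perm_graph n p))"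
    by (auto simp: symmetric_def perm_graph_def Let_def intro: symI)
qed (auto simp: perm_graph_def Let_def)

definition dominating_set :: "('a, 'b) pre_digraph \<Rightarrow> 'a set \<Rightarrow> bool" where
  "dominating_set G D \<longleftrightarrow>
     D \<subseteq> verts G \<and> (\<forall>v \<in> verts G. v \<in> D \<or> (\<exists>u \<in> D. u \<rightarrow>\<^bsub>G\<^esub> v))"

definition domination_number :: "('a, 'b) pre_digraph \<Rightarrow> nat" where
  "domination_number G = Min {card D |D. dominating_set G D}"

(* Min is meaningful only on a finite nonempty set. *)
lemma dominating_set_cards:
  assumes "finite (verts G)"
  shows "finite {card D |D. dominating_set G D}" "{card D |D. dominating_set G D} \<noteq> {}"
proof -
  have "{card D |D. dominating_set G D} \<subseteq> card ` Pow (verts G)"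
    by (auto simp: dominating_set_def)
  then show "finite {card D |D. dominating_set G D}"
    using assms by (meson finite_Pow_iff finite_imageI finite_subset)
  have "dominating_set G (verts G)"
    by (simp add: dominating_set_def)
  then show "{card D |D. dominating_set G D} \<noteq> {}"
    by blast
qed

definition c :: "nat \<Rightarrow> nat \<Rightarrow> nat" where
  "c n k = card {p. p permutes {1..n} \<and> Digraph_Component.connected (with_proj (perm_graph n p))
                    \<and> domination_number (with_proj (perm_graph n p)) = k}"

definition d :: "nat \<Rightarrow> nat \<Rightarrow> nat" where
  "d n k = card {p. p permutes {1..n} \<and> \<not> Digraph_Component.connected (with_proj (perm_graph n p))
                    \<and> domination_number (with_proj (perm_graph n p)) = k}"

definition compositions :: "nat \<Rightarrow> nat \<Rightarrow> nat list set" where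
  "compositions m l = {xs. length xs = l \<and> (\<forall>x \<in> set xs. x \<ge> 1) \<and> sum_list xs = m}"

definition size_lists :: "nat \<Rightarrow> nat list \<Rightarrow> nat list set" where
  "size_lists n rs =
     {ns. length ns = length rs \<and> (\<forall>x \<in> set ns. x \<ge> 1) \<and> sorted_wrt (<) ns
          \<and> (\<Sum>i<length rs. rs ! i * ns ! i) = n}"

definition multinomial :: "nat \<Rightarrow> nat list \<Rightarrow> nat" where
  "multinomial r rs = fact r div (\<Prod>x\<leftarrow>rs. fact x)"

(* A sum over an infinite index set would be 0. *)
lemma finite_compositions: "finite (compositions m l)"
proof (rule finite_subset)
  show "compositions m l \<subseteq> {xs. set xs \<subseteq> {..m} \<and> length xs = l}"
    by (auto simp: compositions_def member_le_sum_list)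
qed (simp add: finite_lists_length_eq)

lemma finite_size_lists:
  assumes "rs \<in> compositions r l"
  shows "finite (size_lists n rs)"
proof (rule finite_subset)
  show "size_lists n rs \<subseteq> {ns. set ns \<subseteq> {..n} \<and> length ns = length rs}"
  proof safe
    fix ns x assume ns: "ns \<in> size_lists n rs" and "x \<in> set ns"
    then obtain j where j: "j < length rs" "x = ns ! j"
      by (auto simp: size_lists_def in_set_conv_nth)
    have "1 \<le> rs ! j"
      using assms j by (auto simp: compositions_def)
    then have "x \<le> rs ! j * ns ! j"
      using j by simp
    also have "\<dots> \<le> (\<Sum>i<length rs. rs ! i * ns ! i)"
      using j by (intro member_le_sum) auto
    finally show "x \<le> n"
      using ns by (simp add: size_lists_def)
  qed (auto simp: size_lists_def)
qed (simp add: finite_lists_length_eq)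

end

(* Passing to q = inv p, the graph has an edge between i < j iff q j < q i, and it is connected iff
   q preserves no proper prefix {1..m}. Splitting off the shortest preserved prefix writes q uniquely
   as a direct sum of an indecomposable permutation and an arbitrary one. The domination number is
   additive under direct sums, so the bivariate generating functions T of all permutations and P of
   the connected ones satisfy T = 1 + P * T. Hence T is the sum of the P ^ r, and the terms with
   r >= 2 count the disconnected graphs. Expanding P ^ r as a power series in the size gives a sum
   over compositions n_1 + ... + n_r = n; grouping these by their multiset of parts produces the
   multinomial coefficients. *)
theory Submission
  imports Defs "HOL-Computational_Algebra.Formal_Power_Series" "HOL-Combinatorics.Multiset_Permutations"
begin

unbundle fps_syntax

section \<open>Connectedness and domination in terms of the inverse permutation\<close>

text \<open>Symmetric in \<open>i\<close> and \<open>j\<close>, so that with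
  \<open>q = inv p\<close> it describes the arcs of \<open>perm_graph n p\<close> in both
  orientations at once.\<close>

definition inverted :: "(nat \<Rightarrow> nat) \<Rightarrow> nat \<Rightarrow> nat \<Rightarrow> bool" where
  "inverted q i j \<longleftrightarrow> i < j \<and> q j < q i \<or> j < i \<and> q i < q j"

definition dom_sets :: "nat \<Rightarrow> (nat \<Rightarrow> nat) \<Rightarrow> nat set set" where
  "dom_sets n q = {D. D \<subseteq> {1..n} \<and> (\<forall>v\<in>{1..n}. v \<in> D \<or> (\<exists>u\<in>D. inverted q u v))}"

definition dom_num :: "nat \<Rightarrow> (nat \<Rightarrow> nat) \<Rightarrow> nat" where
  "dom_num n q = Min (card ` dom_sets n q)"

text \<open>The condition \<open>n \<ge> 1\<close> mirrors the digraph notion of connectedness,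
  which excludes the empty graph. It also makes the constant term of P vanish.\<close>

definition indecomposable :: "nat \<Rightarrow> (nat \<Rightarrow> nat) \<Rightarrow> bool" where
  "indecomposable n q \<longleftrightarrow> n \<ge> 1 \<and> (\<forall>m\<in>{1..<n}. q ` {1..m} \<noteq> {1..m})"

lemma inverted_sym: "inverted q i j \<longleftrightarrow> inverted q j i"
  by (auto simp: inverted_def)

lemma arcs_perm_graph:
  "parcs (perm_graph n p) = {(i, j). i \<in> {1..n} \<and> j \<in> {1..n} \<and> inverted (inv p) i j}"
  by (auto simp: perm_graph_def Let_def inverted_def)

lemma verts_perm_graph: "pverts (perm_graph n p) = {1..n}"
  by (simp add: perm_graph_def)

lemma domination_number_perm_graph:
  "domination_number (with_proj (perm_graph n p)) = dom_num n (inv p)"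
proof -
  have "dominating_set (with_proj (perm_graph n p)) D \<longleftrightarrow> D \<in> dom_sets n (inv p)" for D
    unfolding dominating_set_def dom_sets_def with_proj_simps arcs_perm_graph verts_perm_graph
    by blast
  then show ?thesis
    unfolding domination_number_def dom_num_def by (intro arg_cong[where f = Min]) auto
qed

text \<open>By counting: the image of \<open>{1..m}\<close> has m elements, so if it is not the
  prefix itself, some position up to m gets a value above m, and some value up to m is taken at a
  position after m. These two positions form an inversion across m.\<close>

lemma permutes_image_prefix:
  fixes q :: "nat \<Rightarrow> nat"
  assumes "q permutes {1..n}" "m \<le> n" "\<And>i j. 1 \<le> i \<Longrightarrow> i \<le> m \<Longrightarrow> m < j \<Longrightarrow> j \<le> n \<Longrightarrow> q i \<le> q j"
  shows "q ` {1..m} = {1..m}"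
proof (rule ccontr)
  assume ne: "q ` {1..m} \<noteq> {1..m}"
  have inj: "inj q" using assms(1) by (rule permutes_inj)
  have sub: "q ` {1..m} \<subseteq> {1..n}"
    using permutes_image[OF assms(1)] assms(2) by fastforce
  have cd: "card (q ` {1..m}) = m"
    using inj by (simp add: card_image inj_on_subset[OF inj])
  have "\<not> q ` {1..m} \<subseteq> {1..m}"
    using ne cd by (metis card_atLeastAtMost card_subset_eq diff_Suc_1 finite_atLeastAtMost)
  then obtain i where i: "1 \<le> i" "i \<le> m" "q i > m"
    using sub by fastforce
  have "\<not> {1..m} \<subseteq> q ` {1..m}"
    using ne cd by (metis card_atLeastAtMost card_subset_eq diff_Suc_1 finite_atLeastAtMost finite_imageI)
  then obtain b where b: "1 \<le> b" "b \<le> m" "b \<notin> q ` {1..m}"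
    by (meson atLeastAtMost_iff subsetI)
  have "b \<in> q ` {1..n}"
    using permutes_image[OF assms(1)] b assms(2) by auto
  then obtain j where j: "b = q j" "1 \<le> j" "j \<le> n" by auto
  then have "m < j" using b by (meson atLeastAtMost_iff image_eqI not_le)
  then show False using assms(3)[of i j] i j b by auto
qed

text \<open>For the implication from right to left, the set reachable from 1 is downward closed, because an edge that
  jumps over i has an endpoint adjacent to i; if it were a proper prefix, some edge would leave it.\<close>

lemma connected_perm_graph_iff:
  assumes p: "p permutes {1..n}"
  shows "Digraph_Component.connected (with_proj (perm_graph n p)) \<longleftrightarrow> indecomposable n (inv p)"
proof -
  define q where "q = inv p"
  have q: "q permutes {1..n}" unfolding q_def by (rule permutes_inv[OF p])
  define E where "E = {(i, j). i \<in> {1..n} \<and> j \<in> {1..n} \<and> inverted q i j}"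
  define R where "R = rtrancl_on {1..n} E"
  \<comment> \<open>\<open>connected_conv\<close> speaks of reachability along the symmetric closure
    of the arcs; the arcs here are symmetric already.\<close>
  have "E\<^sup>s = E"
    by (auto simp: symcl_def E_def inverted_sym)
  then have conn: "Digraph_Component.connected (with_proj (perm_graph n p)) \<longleftrightarrow>
      {1..n} \<noteq> {} \<and> (\<forall>u\<in>{1..n}. \<forall>v\<in>{1..n}. (u, v) \<in> R)"
    unfolding connected_conv with_proj_simps verts_perm_graph arcs_perm_graph
    by (simp add: R_def E_def q_def)
  have symE: "E\<inverse> = E"
    by (auto simp: E_def inverted_sym)
  have symR: "(v, u) \<in> R" if "(u, v) \<in> R" for u v
    using rtrancl_on_converseI[of u v "{1..n}" E] that symE by (simp add: R_def)
  have inE: "(u, v) \<in> E" if "u \<in> {1..n}" "v \<in> {1..n}" "inverted q u v" for u v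
    using that by (simp add: E_def)
  show ?thesis
  proof
    assume *: "Digraph_Component.connected (with_proj (perm_graph n p))"
    have "q ` {1..m} \<noteq> {1..m}" if m: "1 \<le> m" "m < n" for m
    proof
      assume im: "q ` {1..m} = {1..m}"
      \<comment> \<open>If y is in the preserved prefix and z is not, then \<open>q y\<close> is at
        most m and \<open>q z\<close> is above m, so y and z are not inverted and no edge leaves the
        prefix.\<close>
      have stay: "v \<le> m" if "(u, v) \<in> R" "u \<le> m" for u v
        using that(1)[unfolded R_def] that(2)
      proof (induction rule: rtrancl_on_induct)
        case (step y z)
        show ?case
        proof (rule ccontr)
          assume z: "\<not> z \<le> m"
          have "q y \<in> {1..m}" using im step by auto
          moreover have "q z \<notin> q ` {1..m}"
            using z permutes_inj[OF q] by (auto simp: inj_eq)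
          then have "q z \<notin> {1..m}" using im by simp
          moreover have "q z \<in> {1..n}" using permutes_in_image[OF q] step by blast
          ultimately show False using step z by (auto simp: E_def inverted_def)
        qed
      qed
      have "(1, n) \<in> R" using * m by (auto simp: conn)
      then show False using stay[of 1 n] m by auto
    qed
    then show "indecomposable n (inv p)"
      using * by (auto simp: indecomposable_def conn q_def)
  next
    assume "indecomposable n (inv p)"
    then have n: "n \<ge> 1" and ind: "\<And>m. 1 \<le> m \<Longrightarrow> m < n \<Longrightarrow> q ` {1..m} \<noteq> {1..m}"
      by (auto simp: indecomposable_def q_def)
    have ext: "(1, v) \<in> R" if "(1, u) \<in> R" "(u, v) \<in> E" for u v
      using that unfolding R_def by (auto intro: rtrancl_on_into_rtrancl_on simp: E_def)
    have down: "(1, i) \<in> R" if "(1, x) \<in> R" "1 \<le> i" "i \<le> x" for i x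
      using that(1)[unfolded R_def] that(2,3)
    proof (induction arbitrary: i rule: rtrancl_on_induct)
      case base
      then have "i = 1" by simp
      then show ?case using n by (simp add: R_def)
    next
      case (step y z)
      have y: "(1, y) \<in> R" using step.hyps(1) by (simp add: R_def)
      then have z: "(1, z) \<in> R" using step.hyps(2) by (rule ext)
      consider "i \<le> y" | "i = z" | "y < i" "i < z" using step.prems by linarith
      then show ?case
      proof cases
        case 1
        then show ?thesis using step by blast
      next
        case 2
        then show ?thesis using z by simp
      next
        case 3
        have "inverted q y z" using step by (simp add: E_def)
        \<comment> \<open>Since \<open>q z < q y\<close>, the value \<open>q i\<close> lies below
          \<open>q y\<close> or above \<open>q z\<close>.\<close>
        then have "inverted q y i \<or> inverted q z i"
          using 3 by (auto simp: inverted_def)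
        moreover have "i \<in> {1..n}" using 3 step by auto
        ultimately show ?thesis using ext[OF y] ext[OF z] inE step.hyps by blast
      qed
    qed
    define M where "M = Max {x. (1, x) \<in> R}"
    have fin: "finite {x. (1, x) \<in> R}"
      by (rule finite_subset[of _ "{1..n}"]) (auto simp: R_def dest: in_rtrancl_on_in_F)
    have one: "(1, 1) \<in> R" using n by (simp add: R_def)
    have M: "(1, M) \<in> R"
      using Max_in[OF fin] one unfolding M_def by blast
    have Mge: "x \<le> M" if "(1, x) \<in> R" for x
      using Max_ge[OF fin] that unfolding M_def by blast
    have M_bounds: "1 \<le> M" "M \<le> n"
      using M by (auto simp: R_def dest: in_rtrancl_on_in_F)
    have "M = n"
    proof (rule ccontr)
      assume "M \<noteq> n"
      then have "M < n" using M_bounds by simp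
      then have "q ` {1..M} \<noteq> {1..M}" using ind M_bounds by blast
      \<comment> \<open>The contrapositive of \<open>permutes_image_prefix\<close> supplies an
        inversion straddling M, that is, an edge out of the reachable set.\<close>
      then obtain i j where ij: "1 \<le> i" "i \<le> M" "M < j" "j \<le> n" "\<not> q i \<le> q j"
        using permutes_image_prefix[OF q M_bounds(2)] by metis
      have "(1, i) \<in> R" using down[OF M] ij by simp
      moreover have "(i, j) \<in> E" using ij by (intro inE) (auto simp: inverted_def)
      ultimately have "(1, j) \<in> R" by (rule ext)
      then show False using Mge ij by fastforce
    qed
    then have all: "(1, v) \<in> R" if "v \<in> {1..n}" for v
      using down[OF M] that by simp
    have "(u, v) \<in> R" if "u \<in> {1..n}" "v \<in> {1..n}" for u v
      using symR[OF all[OF that(1)]] all[OF that(2)] rtrancl_on_trans unfolding R_def by metis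
    then show "Digraph_Component.connected (with_proj (perm_graph n p))"
      using n by (simp add: conn)
  qed
qed

section \<open>Direct sum decomposition\<close>

definition perms_dom :: "nat \<Rightarrow> nat \<Rightarrow> (nat \<Rightarrow> nat) set" where
  "perms_dom n k = {q. q permutes {1..n} \<and> dom_num n q = k}"

lemma finite_perms_dom: "finite (perms_dom n k)"
  unfolding perms_dom_def
  by (rule finite_subset[OF _ finite_permutations[of "{1..n}"]]) auto

text \<open>Taking inverses is an involution on the permutations of S. This moves the counts in
  \<open>c\<close> and \<open>d\<close> from p to q.\<close>

lemma card_Collect_permutes_inv:
  "card {p. p permutes S \<and> Q (inv p)} = card {q. q permutes S \<and> Q q}"
proof (rule bij_betw_same_card[of inv], rule bij_betw_byWitness[where f' = inv])
qed (auto simp: permutes_inv permutes_inv_inv)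

lemma c_eq: "c n k = card {q \<in> perms_dom n k. indecomposable n q}"
proof -
  have "c n k = card {p. p permutes {1..n} \<and> indecomposable n (inv p) \<and> dom_num n (inv p) = k}"
    unfolding c_def domination_number_perm_graph
    by (rule arg_cong[where f = card]) (auto simp: connected_perm_graph_iff)
  also have "\<dots> = card {q. q permutes {1..n} \<and> indecomposable n q \<and> dom_num n q = k}"
    by (rule card_Collect_permutes_inv)
  finally show ?thesis
    by (simp add: perms_dom_def conj_ac)
qed

lemma c_plus_d: "c n k + d n k = card (perms_dom n k)"
proof -
  have "d n k = card {p. p permutes {1..n} \<and> \<not> indecomposable n (inv p) \<and> dom_num n (inv p) = k}"
    unfolding d_def domination_number_perm_graph
    by (rule arg_cong[where f = card]) (auto simp: connected_perm_graph_iff)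
  also have "\<dots> = card {q. q permutes {1..n} \<and> \<not> indecomposable n q \<and> dom_num n q = k}"
    by (rule card_Collect_permutes_inv)
  also have "\<dots> = card {q \<in> perms_dom n k. \<not> indecomposable n q}"
    by (simp add: perms_dom_def conj_ac)
  finally show ?thesis
    \<comment> \<open>With the constant 1 on both branches, this splits the cardinality into
      indecomposable and other permutations.\<close>
    using sum.If_cases[OF finite_perms_dom, of "indecomposable n" "\<lambda>_. 1::nat" "\<lambda>_. 1" n k]
    by (simp add: c_eq Int_def)
qed

lemma c_0_left: "c 0 k = 0"
  by (simp add: c_eq indecomposable_def)

lemma finite_dom_sets: "finite (dom_sets n q)"
  by (rule finite_subset[of _ "Pow {1..n}"]) (auto simp: dom_sets_def)

lemma dom_sets_nonempty: "dom_sets n q \<noteq> {}"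
  by (auto simp: dom_sets_def)

text \<open>The empty set dominates no nonempty graph. Hence the series in the domination number
  have no constant term, which later restricts the k's to positive values and bounds r by k.\<close>

lemma c_0_right: "c n 0 = 0"
proof (cases "n = 0")
  case False
  have "dom_num n q \<noteq> 0" for q
  proof
    assume "dom_num n q = 0"
    then have "0 \<in> card ` dom_sets n q"
      unfolding dom_num_def using Min_in[of "card ` dom_sets n q"] finite_dom_sets dom_sets_nonempty
      by (metis finite_imageI image_is_empty)
    then obtain D where D: "D \<in> dom_sets n q" "card D = 0" by auto
    then have "D = {}"
      by (metis (lifting) card_eq_0_iff dom_sets_def finite_atLeastAtMost finite_subset mem_Collect_eq)
    then show False using D False by (auto simp: dom_sets_def)
  qed
  then have "perms_dom n 0 = {}" by (simp add: perms_dom_def)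
  then show ?thesis by (simp add: c_eq)
qed (simp add: c_0_left)

text \<open>The source of the summand 1 in T = 1 + P * T.\<close>

lemma perms_dom_0: "perms_dom 0 k = (if k = 0 then {id} else {})"
  by (auto simp: perms_dom_def dom_num_def dom_sets_def)

section \<open>Direct sums of permutations and additivity of the domination number\<close>

definition perm_sum :: "nat \<Rightarrow> (nat \<Rightarrow> nat) \<Rightarrow> (nat \<Rightarrow> nat) \<Rightarrow> nat \<Rightarrow> nat" where
  "perm_sum m q\<^sub>1 q\<^sub>2 i = (if i \<le> m then q\<^sub>1 i else q\<^sub>2 (i - m) + m)"

lemma permutes_prefix_le: "q permutes {1..m} \<Longrightarrow> i \<le> m \<Longrightarrow> q i \<le> (m::nat)"
  by (cases "i = 0") (auto simp: permutes_not_in dest: permutes_in_image[of _ _ i])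

lemma perm_sum_permutes:
  assumes q1: "q\<^sub>1 permutes {1..m}" and q2: "q\<^sub>2 permutes {1..n}"
  shows "perm_sum m q\<^sub>1 q\<^sub>2 permutes {1..m + n}"
proof (rule bij_imp_permutes)
  have inj1: "q\<^sub>1 x = q\<^sub>1 y \<longleftrightarrow> x = y" and inj2: "q\<^sub>2 x = q\<^sub>2 y \<longleftrightarrow> x = y" for x y
    using inj_eq[OF permutes_inj[OF q1]] inj_eq[OF permutes_inj[OF q2]] by simp_all
  have r1: "q\<^sub>1 i \<in> {1..m}" if "i \<in> {1..m}" for i using permutes_in_image[OF q1] that by blast
  have r2: "q\<^sub>2 i \<in> {1..n}" if "i \<in> {1..n}" for i using permutes_in_image[OF q2] that by blast
  have inj: "inj_on (perm_sum m q\<^sub>1 q\<^sub>2) {1..m + n}"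
  proof (rule inj_onI)
    fix x y assume xy: "x \<in> {1..m + n}" "y \<in> {1..m + n}" "perm_sum m q\<^sub>1 q\<^sub>2 x = perm_sum m q\<^sub>1 q\<^sub>2 y"
    then show "x = y"
      using r1[of x] r1[of y] r2[of "x - m"] r2[of "y - m"] inj1[of x y] inj2[of "x - m" "y - m"]
      by (cases "x \<le> m"; cases "y \<le> m") (simp_all add: perm_sum_def; linarith)+
  qed
  have "perm_sum m q\<^sub>1 q\<^sub>2 ` {1..m + n} \<subseteq> {1..m + n}"
  proof safe
    fix x assume "x \<in> {1..m + n}"
    then show "perm_sum m q\<^sub>1 q\<^sub>2 x \<in> {1..m + n}"
      using r1[of x] r2[of "x - m"] by (cases "x \<le> m") (simp_all add: perm_sum_def; linarith)+
  qed
  then show "bij_betw (perm_sum m q\<^sub>1 q\<^sub>2) {1..m + n} {1..m + n}"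
    using inj by (simp add: bij_betw_def endo_inj_surj)
  fix x assume "x \<notin> {1..m + n}"
  then show "perm_sum m q\<^sub>1 q\<^sub>2 x = x"
    using permutes_not_in[OF q1, of x] permutes_not_in[OF q2, of "x - m"]
    by (cases "x \<le> m") (simp_all add: perm_sum_def; linarith)+
qed

text \<open>Whether a prefix of length at most m is preserved depends on \<open>q\<^sub>1\<close>
  alone; both existence and uniqueness of the decomposition rest on this.\<close>

lemma perm_sum_image_prefix: "m' \<le> m \<Longrightarrow> perm_sum m q\<^sub>1 q\<^sub>2 ` {1..m'} = q\<^sub>1 ` {1..m'}"
  by (auto simp: perm_sum_def intro!: image_cong)

lemma perm_sum_decompose:
  assumes q: "q permutes {1..m + n}" and im: "q ` {1..m} = {1..m}"
  obtains q\<^sub>1 q\<^sub>2 where "q\<^sub>1 permutes {1..m}" "q\<^sub>2 permutes {1..n}" "q = perm_sum m q\<^sub>1 q\<^sub>2"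
proof -
  have inj: "q x = q y \<longleftrightarrow> x = y" for x y using permutes_inj[OF q] by (rule inj_eq)
  define q\<^sub>1 where "q\<^sub>1 i = (if i \<le> m then q i else i)" for i
  define q\<^sub>2 where "q\<^sub>2 i = (if i = 0 then 0 else q (i + m) - m)" for i
  have q0: "q 0 = 0" using permutes_not_in[OF q, of 0] by simp
  \<comment> \<open>The values 1 to m are used up by the prefix and 0 is fixed, so by injectivity
    only values above m remain.\<close>
  have big: "q i > m" if "i > m" for i
  proof (rule ccontr)
    assume "\<not> q i > m"
    moreover have "q i \<noteq> 0" using that q0 inj[of i 0] by auto
    ultimately have "q i \<in> q ` {1..m}" using im by auto
    then show False using that inj by auto
  qed
  have "q\<^sub>1 permutes {1..m}"
  proof (rule bij_imp_permutes)
    have "q\<^sub>1 ` {1..m} = {1..m}" using im by (auto simp: q\<^sub>1_def image_def)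
    moreover have "inj_on q\<^sub>1 {1..m}" by (auto simp: inj_on_def q\<^sub>1_def inj)
    ultimately show "bij_betw q\<^sub>1 {1..m} {1..m}" by (simp add: bij_betw_def)
  qed (auto simp: q\<^sub>1_def q0 not_le)
  moreover have "q\<^sub>2 permutes {1..n}"
  proof (rule bij_imp_permutes)
    have "inj_on q\<^sub>2 {1..n}"
    proof (rule inj_onI)
      fix x y assume "x \<in> {1..n}" "y \<in> {1..n}" "q\<^sub>2 x = q\<^sub>2 y"
      then have "q (x + m) = q (y + m)"
        using big[of "x + m"] big[of "y + m"] by (auto simp: q\<^sub>2_def)
      then show "x = y" by (simp add: inj)
    qed
    moreover have "q\<^sub>2 ` {1..n} \<subseteq> {1..n}"
    proof safe
      fix x assume x: "x \<in> {1..n}"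
      then have "q (x + m) \<in> {1..m + n}" using permutes_in_image[OF q, of "x + m"] by auto
      then show "q\<^sub>2 x \<in> {1..n}" using x big[of "x + m"] by (auto simp: q\<^sub>2_def)
    qed
    ultimately show "bij_betw q\<^sub>2 {1..n} {1..n}" by (simp add: bij_betw_def endo_inj_surj)
    fix x assume "x \<notin> {1..n}"
    then show "q\<^sub>2 x = x" using permutes_not_in[OF q, of "x + m"] by (auto simp: q\<^sub>2_def)
  qed
  moreover have "q = perm_sum m q\<^sub>1 q\<^sub>2"
  proof
    fix i show "q i = perm_sum m q\<^sub>1 q\<^sub>2 i"
      using big[of i] by (auto simp: perm_sum_def q\<^sub>1_def q\<^sub>2_def)
  qed
  ultimately show thesis by (rule that)
qed

text \<open>The graph of a direct sum is the disjoint union of the two graphs, so a set dominates it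
  exactly when its two parts dominate their blocks.\<close>

lemma dom_sets_perm_sum:
  assumes q1: "q\<^sub>1 permutes {1..m}"
  shows "dom_sets (m + n) (perm_sum m q\<^sub>1 q\<^sub>2) =
    (\<lambda>(A, B). A \<union> (+) m ` B) ` (dom_sets m q\<^sub>1 \<times> dom_sets n q\<^sub>2)"
proof -
  let ?q = "perm_sum m q\<^sub>1 q\<^sub>2"
  have low: "inverted ?q u v \<longleftrightarrow> inverted q\<^sub>1 u v" if "u \<le> m" "v \<le> m" for u v
    using that by (simp add: inverted_def perm_sum_def)
  have high: "inverted ?q (m + u) (m + v) \<longleftrightarrow> inverted q\<^sub>2 u v" if "u \<ge> 1" "v \<ge> 1" for u v
    using that by (simp add: inverted_def perm_sum_def)
  \<comment> \<open>Values on the left block are at most m and those on the right are at least m, so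
    no strict inversion crosses the cut.\<close>
  have mixed: "\<not> inverted ?q u v" "\<not> inverted ?q v u" if "u \<le> m" "m < v" for u v
    using that permutes_prefix_le[OF q1, of u] by (auto simp: inverted_def perm_sum_def)
  show ?thesis
  proof (intro equalityI subsetI)
    fix D assume D: "D \<in> dom_sets (m + n) ?q"
    define A where "A = D \<inter> {1..m}"
    define B where "B = {i \<in> {1..n}. m + i \<in> D}"
    have Dsub: "D \<subseteq> {1..m + n}" using D by (auto simp: dom_sets_def)
    have "D = A \<union> (+) m ` B"
    proof (intro equalityI subsetI)
      fix x assume x: "x \<in> D"
      then have xn: "x \<in> {1..m + n}" using Dsub by auto
      show "x \<in> A \<union> (+) m ` B"
      proof (cases "x \<le> m")
        case True
        then show ?thesis using x xn by (simp add: A_def)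
      next
        case False
        then have "x - m \<in> B" "x = m + (x - m)" using x xn by (auto simp: B_def)
        then show ?thesis by blast
      qed
    qed (auto simp: A_def B_def)
    moreover have "A \<in> dom_sets m q\<^sub>1"
      unfolding dom_sets_def
    proof (intro CollectI conjI ballI)
      show "A \<subseteq> {1..m}" by (simp add: A_def)
      fix v assume v: "v \<in> {1..m}"
      then have "v \<in> D \<or> (\<exists>u\<in>D. inverted ?q u v)" using D by (auto simp: dom_sets_def)
      then show "v \<in> A \<or> (\<exists>u\<in>A. inverted q\<^sub>1 u v)"
      proof
        assume "\<exists>u\<in>D. inverted ?q u v"
        then obtain u where u: "u \<in> D" "inverted ?q u v" by blast
        have "u \<le> m" using u v mixed[of v u] by fastforce
        then show ?thesis using u v Dsub low[of u v] by (auto simp: A_def)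
      qed (use v in \<open>simp add: A_def\<close>)
    qed
    moreover have "B \<in> dom_sets n q\<^sub>2"
      unfolding dom_sets_def
    proof (intro CollectI conjI ballI)
      show "B \<subseteq> {1..n}" by (auto simp: B_def)
      fix v assume v: "v \<in> {1..n}"
      then have "m + v \<in> {1..m + n}" by simp
      then have "m + v \<in> D \<or> (\<exists>u\<in>D. inverted ?q u (m + v))" using D by (auto simp: dom_sets_def)
      then show "v \<in> B \<or> (\<exists>u\<in>B. inverted q\<^sub>2 u v)"
      proof
        assume "\<exists>u\<in>D. inverted ?q u (m + v)"
        then obtain u where u: "u \<in> D" "inverted ?q u (m + v)" by blast
        have um: "u > m" using u v mixed[of u "m + v"] by fastforce
        then have "u - m \<in> B" using u Dsub by (auto simp: B_def)
        moreover have "inverted q\<^sub>2 (u - m) v" using high[of "u - m" v] um u v by simp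
        ultimately show ?thesis by blast
      qed (use v in \<open>simp add: B_def\<close>)
    qed
    ultimately show "D \<in> (\<lambda>(A, B). A \<union> (+) m ` B) ` (dom_sets m q\<^sub>1 \<times> dom_sets n q\<^sub>2)"
      by auto
  next
    fix D assume "D \<in> (\<lambda>(A, B). A \<union> (+) m ` B) ` (dom_sets m q\<^sub>1 \<times> dom_sets n q\<^sub>2)"
    then obtain A B where D: "D = A \<union> (+) m ` B" and A: "A \<in> dom_sets m q\<^sub>1" and B: "B \<in> dom_sets n q\<^sub>2"
      by auto
    have AB: "A \<subseteq> {1..m}" "B \<subseteq> {1..n}" using A B by (auto simp: dom_sets_def)
    show "D \<in> dom_sets (m + n) ?q"
      unfolding dom_sets_def
    proof (intro CollectI conjI ballI)
      show "D \<subseteq> {1..m + n}" using AB by (auto simp: D)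
      fix v assume v: "v \<in> {1..m + n}"
      show "v \<in> D \<or> (\<exists>u\<in>D. inverted ?q u v)"
      proof (cases "v \<le> m")
        case True
        then have "v \<in> A \<or> (\<exists>u\<in>A. inverted q\<^sub>1 u v)" using A v by (auto simp: dom_sets_def)
        moreover have "inverted ?q u v" if "u \<in> A" "inverted q\<^sub>1 u v" for u
          using that low[OF _ True, of u] AB by auto
        ultimately show ?thesis unfolding D by blast
      next
        case False
        then have "v - m \<in> {1..n}" using v by auto
        then have "v - m \<in> B \<or> (\<exists>u\<in>B. inverted q\<^sub>2 u (v - m))" using B by (auto simp: dom_sets_def)
        then show ?thesis
        proof
          assume "v - m \<in> B"
          then have "m + (v - m) \<in> D" unfolding D by blast
          then show ?thesis using False by simp
        next
          assume "\<exists>u\<in>B. inverted q\<^sub>2 u (v - m)"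
          then obtain u where u: "u \<in> B" "inverted q\<^sub>2 u (v - m)" by blast
          have "m + u \<in> D" using u D by blast
          moreover have "inverted ?q (m + u) v"
            using high[of u "v - m"] u AB False by auto
          ultimately show ?thesis by blast
        qed
      qed
    qed
  qed
qed

text \<open>By \<open>dom_sets_perm_sum\<close> the cardinalities of dominating sets form a sumset,
  and the minimum of a sumset is the sum of the minima.\<close>

lemma dom_num_perm_sum:
  assumes q1: "q\<^sub>1 permutes {1..m}"
  shows "dom_num (m + n) (perm_sum m q\<^sub>1 q\<^sub>2) = dom_num m q\<^sub>1 + dom_num n q\<^sub>2"
proof -
  have card: "card (A \<union> (+) m ` B) = card A + card B" if "A \<in> dom_sets m q\<^sub>1" "B \<in> dom_sets n q\<^sub>2" for A B
  proof -
    have sub: "A \<subseteq> {1..m}" "B \<subseteq> {1..n}" using that by (auto simp: dom_sets_def)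
    then have "finite A" "finite B" by (auto intro: finite_subset)
    moreover have "A \<inter> (+) m ` B = {}" using sub by fastforce
    ultimately show ?thesis by (simp add: card_Un_disjoint card_image)
  qed
  have fin: "finite (card ` dom_sets k q)" and ne: "card ` dom_sets k q \<noteq> {}" for k q
    using finite_dom_sets dom_sets_nonempty by simp_all
  have img: "card ` dom_sets (m + n) (perm_sum m q\<^sub>1 q\<^sub>2) =
      (\<lambda>(a, b). a + b) ` (card ` dom_sets m q\<^sub>1 \<times> card ` dom_sets n q\<^sub>2)"
    unfolding dom_sets_perm_sum[OF q1] image_image
    by (force simp: card image_iff)
  show ?thesis
    unfolding dom_num_def
  proof (rule Min_eqI)
    show "finite (card ` dom_sets (m + n) (perm_sum m q\<^sub>1 q\<^sub>2))" by (rule fin)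
    show "Min (card ` dom_sets m q\<^sub>1) + Min (card ` dom_sets n q\<^sub>2) \<in> card ` dom_sets (m + n) (perm_sum m q\<^sub>1 q\<^sub>2)"
      unfolding img using Min_in[OF fin ne, of m q\<^sub>1] Min_in[OF fin ne, of n q\<^sub>2]
      by (intro image_eqI[where x = "(_, _)"]) auto
    fix y assume "y \<in> card ` dom_sets (m + n) (perm_sum m q\<^sub>1 q\<^sub>2)"
    then show "Min (card ` dom_sets m q\<^sub>1) + Min (card ` dom_sets n q\<^sub>2) \<le> y"
      unfolding img using fin by (auto intro!: add_mono Min_le)
  qed
qed

lemma perm_sum_inject:
  assumes "q\<^sub>1 permutes {1..m}" "q\<^sub>1' permutes {1..m}" "q\<^sub>2 permutes {1..n}" "q\<^sub>2' permutes {1..n'}"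
    and eq: "perm_sum m q\<^sub>1 q\<^sub>2 = perm_sum m q\<^sub>1' q\<^sub>2'"
  shows "q\<^sub>1 = q\<^sub>1'" "q\<^sub>2 = q\<^sub>2'"
proof -
  show "q\<^sub>1 = q\<^sub>1'"
  proof
    fix i
    show "q\<^sub>1 i = q\<^sub>1' i"
      using fun_cong[OF eq, of i] permutes_not_in[OF assms(1), of i] permutes_not_in[OF assms(2), of i]
      by (cases "i \<le> m") (auto simp: perm_sum_def)
  qed
  show "q\<^sub>2 = q\<^sub>2'"
  proof
    fix i
    show "q\<^sub>2 i = q\<^sub>2' i"
      using fun_cong[OF eq, of "i + m"] permutes_not_in[OF assms(3), of i] permutes_not_in[OF assms(4), of i]
      by (cases "i = 0") (auto simp: perm_sum_def)
  qed
qed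

text \<open>Cutting at the shortest preserved prefix is a bijection onto pairs of an indecomposable
  and an arbitrary permutation; m is the size of the first summand and j its domination number. This
  is T = 1 + P * T read coefficientwise.\<close>

lemma card_perms_dom_rec:
  assumes n: "n \<ge> 1"
  shows "card (perms_dom n k) = (\<Sum>m\<in>{1..n}. \<Sum>j\<le>k. c m j * card (perms_dom (n - m) (k - j)))"
proof -
  define I where "I = (SIGMA m:{1..n}. SIGMA j:{..k}.
    {q \<in> perms_dom m j. indecomposable m q} \<times> perms_dom (n - m) (k - j))"
  define f where "f = (\<lambda>(m, j :: nat, q\<^sub>1, q\<^sub>2). perm_sum m q\<^sub>1 q\<^sub>2)"
  \<comment> \<open>If \<open>m < m'\<close>, then \<open>q\<^sub>1'\<close> would preserve the
    prefix of length m and be decomposable. Applied in both directions, this determines the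
    cut.\<close>
  have size_le: "m' \<le> m"
    if "q\<^sub>1 permutes {1..m}" "indecomposable m q\<^sub>1" "indecomposable m' q\<^sub>1'"
      "perm_sum m q\<^sub>1 q\<^sub>2 = perm_sum m' q\<^sub>1' q\<^sub>2'" for m m' q\<^sub>1 q\<^sub>1' q\<^sub>2 q\<^sub>2'
  proof (rule ccontr)
    assume less: "\<not> m' \<le> m"
    have "q\<^sub>1' ` {1..m} = {1..m}"
      using perm_sum_image_prefix[of m m q\<^sub>1 q\<^sub>2] perm_sum_image_prefix[of m m' q\<^sub>1' q\<^sub>2'] that less
        permutes_image[OF that(1)] by simp
    then show False using that(2,3) less by (auto simp: indecomposable_def)
  qed
  have inj: "inj_on f I"
  proof (rule inj_onI)
    fix x y assume xy: "x \<in> I" "y \<in> I" "f x = f y"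
    obtain m j q\<^sub>1 q\<^sub>2 where x: "x = (m, j, q\<^sub>1, q\<^sub>2)" by (cases x)
    obtain m' j' q\<^sub>1' q\<^sub>2' where y: "y = (m', j', q\<^sub>1', q\<^sub>2')" by (cases y)
    have eq: "perm_sum m q\<^sub>1 q\<^sub>2 = perm_sum m' q\<^sub>1' q\<^sub>2'" using xy by (simp add: x y f_def)
    have p: "q\<^sub>1 permutes {1..m}" "q\<^sub>1' permutes {1..m'}" "indecomposable m q\<^sub>1" "indecomposable m' q\<^sub>1'"
      "q\<^sub>2 permutes {1..n - m}" "q\<^sub>2' permutes {1..n - m'}" "dom_num m q\<^sub>1 = j" "dom_num m' q\<^sub>1' = j'"
      using xy by (auto simp: I_def x y perms_dom_def)
    have m: "m' = m" using size_le[OF p(1) p(3) p(4) eq] size_le[OF p(2) p(4) p(3) eq[symmetric]] by simp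
    have "q\<^sub>1 = q\<^sub>1'" "q\<^sub>2 = q\<^sub>2'"
      using perm_sum_inject[OF p(1) _ p(5) p(6)] p(2) eq unfolding m by blast+
    then show "x = y" using m p by (simp add: x y)
  qed
  have img: "f ` I = perms_dom n k"
  proof (intro equalityI subsetI)
    fix q assume "q \<in> f ` I"
    then obtain m j q\<^sub>1 q\<^sub>2 where x: "m \<in> {1..n}" "j \<le> k" "q\<^sub>1 permutes {1..m}" "q\<^sub>2 permutes {1..n - m}"
      "dom_num m q\<^sub>1 = j" "dom_num (n - m) q\<^sub>2 = k - j" "q = perm_sum m q\<^sub>1 q\<^sub>2"
      by (auto simp: I_def f_def perms_dom_def)
    then show "q \<in> perms_dom n k"
      using perm_sum_permutes[OF x(3,4)] dom_num_perm_sum[OF x(3), of "n - m" q\<^sub>2] by (auto simp: perms_dom_def)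
  next
    fix q assume "q \<in> perms_dom n k"
    then have q: "q permutes {1..n}" "dom_num n q = k" by (auto simp: perms_dom_def)
    \<comment> \<open>The whole interval \<open>{1..n}\<close> is a preserved prefix, so the least
      one exists; minimality makes its restriction indecomposable.\<close>
    define m where "m = (LEAST m. m \<ge> 1 \<and> q ` {1..m} = {1..m})"
    have nn: "n \<ge> 1 \<and> q ` {1..n} = {1..n}" using n permutes_image[OF q(1)] by simp
    have m: "m \<ge> 1 \<and> q ` {1..m} = {1..m}" unfolding m_def by (rule LeastI[of _ n]) (rule nn)
    have mn: "m \<le> n" unfolding m_def by (rule Least_le) (rule nn)
    have least: "q ` {1..m'} \<noteq> {1..m'}" if "1 \<le> m'" "m' < m" for m'
      using not_less_Least[of m' "\<lambda>m. m \<ge> 1 \<and> q ` {1..m} = {1..m}"] that by (simp add: m_def)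
    obtain q\<^sub>1 q\<^sub>2 where q12: "q\<^sub>1 permutes {1..m}" "q\<^sub>2 permutes {1..n - m}" "q = perm_sum m q\<^sub>1 q\<^sub>2"
      using perm_sum_decompose[of q m "n - m"] q m mn by auto
    have "indecomposable m q\<^sub>1"
      unfolding indecomposable_def
    proof (intro conjI ballI)
      fix m' assume "m' \<in> {1..<m}"
      then show "q\<^sub>1 ` {1..m'} \<noteq> {1..m'}"
        using perm_sum_image_prefix[of m' m q\<^sub>1 q\<^sub>2] least[of m'] q12 by simp
    qed (use m in simp)
    moreover have "dom_num m q\<^sub>1 + dom_num (n - m) q\<^sub>2 = k"
      using dom_num_perm_sum[OF q12(1), of "n - m" q\<^sub>2] q q12 mn by simp
    ultimately have "(m, dom_num m q\<^sub>1, q\<^sub>1, q\<^sub>2) \<in> I"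
      using q12 m mn by (auto simp: I_def perms_dom_def)
    then show "q \<in> f ` I" using q12 by (force simp: f_def)
  qed
  have "card (perms_dom n k) = card I"
    using card_image[OF inj] img by simp
  also have "\<dots> = (\<Sum>m\<in>{1..n}. \<Sum>j\<le>k. c m j * card (perms_dom (n - m) (k - j)))"
    by (simp add: I_def c_eq finite_perms_dom card_cartesian_product)
  finally show ?thesis .
qed

section \<open>Coefficients of products of power series\<close>

text \<open>Induction that splits off the last factor by the Cauchy product. Semiring coefficients
  allow both natural numbers and power series over them. Lists in \<open>natpermute k l\<close> may
  contain zeros.\<close>

lemma fps_prod_lessThan_nth:
  fixes f :: "nat \<Rightarrow> 'a::comm_semiring_1 fps"
  shows "(\<Prod>i<l. f i) $ k = (\<Sum>xs\<in>natpermute k l. \<Prod>i<l. f i $ (xs ! i))"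
proof (induction l arbitrary: k)
  case 0
  then show ?case by (simp add: natpermute_0)
next
  case (Suc l)
  have "(\<Prod>i<Suc l. f i) $ k = (\<Sum>j\<le>k. \<Sum>xs\<in>natpermute j l. (\<Prod>i<l. f i $ (xs ! i)) * f l $ (k - j))"
    by (simp add: fps_mult_nth Suc.IH sum_distrib_right atLeast0AtMost)
  also have "\<dots> = (\<Sum>(j, xs)\<in>(SIGMA j:{..k}. natpermute j l). (\<Prod>i<l. f i $ (xs ! i)) * f l $ (k - j))"
    by (rule sum.Sigma) (auto simp: natpermute_finite)
  also have "\<dots> = (\<Sum>ys\<in>natpermute k (Suc l). \<Prod>i<Suc l. f i $ (ys ! i))"
  \<comment> \<open>The index of the last factor is forced to be \<open>k - j\<close>; appending it
    and dropping it are mutually inverse.\<close>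
  proof (rule sum.reindex_bij_witness[where i = "\<lambda>ys. (sum_list (butlast ys), butlast ys)"
        and j = "\<lambda>(j, xs). xs @ [k - j]"], goal_cases)
    case (4 ys)
    then have ys: "length ys = Suc l" "sum_list ys = k" by (auto simp: natpermute_def)
    then have "butlast ys @ [last ys] = ys"
      by (intro append_butlast_last_id) auto
    then have "sum_list (butlast ys) + last ys = k"
      using ys by (metis sum_list.Cons sum_list.Nil sum_list_append add.right_neutral)
    then show ?case using ys by (auto simp: natpermute_def)
  next
    case (3 ys)
    then have ys: "length ys = Suc l" "sum_list ys = k" by (auto simp: natpermute_def)
    then have "butlast ys @ [last ys] = ys"
      by (intro append_butlast_last_id) auto
    moreover from this have "sum_list (butlast ys) + last ys = k"
      using ys by (metis sum_list.Cons sum_list.Nil sum_list_append add.right_neutral)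
    ultimately show ?case by auto
  next
    case (5 x)
    then show ?case by (auto simp: natpermute_def nth_append intro!: prod.cong)
  qed (auto simp: natpermute_def)
  finally show ?case .
qed

lemma natpermute_positive: "{xs \<in> natpermute k l. \<forall>i<l. xs ! i \<ge> 1} = compositions k l"
  by (auto simp: natpermute_def compositions_def all_set_conv_all_nth)

lemma compositions_bounds:
  assumes "xs \<in> compositions k l"
  shows "l \<le> k" "i < l \<Longrightarrow> 1 \<le> xs ! i"
proof -
  have "length xs \<le> sum_list xs" if "\<forall>x\<in>set xs. (1::nat) \<le> x" for xs
    using that by (induction xs) auto
  then show "l \<le> k" using assms by (auto simp: compositions_def)
  show "i < l \<Longrightarrow> 1 \<le> xs ! i" using assms by (auto simp: compositions_def)
qed

text \<open>A zero entry picks a vanishing constant term, so only lists of positive entries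
  contribute.\<close>

lemma fps_prod_lessThan_nth_compositions:
  fixes f :: "nat \<Rightarrow> 'a::comm_semiring_1 fps"
  assumes "\<And>i. i < l \<Longrightarrow> f i $ 0 = 0"
  shows "(\<Prod>i<l. f i) $ k = (\<Sum>xs\<in>compositions k l. \<Prod>i<l. f i $ (xs ! i))"
proof -
  have "(\<Prod>i<l. f i $ (xs ! i)) = 0" if "i < l" "\<not> xs ! i \<ge> 1" for i xs
    using that assms[of i] by (intro prod_zero bexI[of _ i]) (auto simp: not_less_eq_eq)
  then show ?thesis
    unfolding fps_prod_lessThan_nth natpermute_positive[symmetric]
    by (intro sum.mono_neutral_right) (auto simp: natpermute_finite)
qed

text \<open>There is no composition of k into more than k parts.\<close>

lemma fps_prod_lessThan_nth_eq_0:
  fixes f :: "nat \<Rightarrow> 'a::comm_semiring_1 fps"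
  assumes "\<And>i. i < l \<Longrightarrow> f i $ 0 = 0" "k < l"
  shows "(\<Prod>i<l. f i) $ k = 0"
proof -
  have "compositions k l = {}"
    using assms(2) compositions_bounds(1) by (metis all_not_in_conv not_le)
  then show ?thesis
    using assms(1) by (simp add: fps_prod_lessThan_nth_compositions)
qed

lemma fps_power_nth_compositions:
  fixes f :: "'a::comm_semiring_1 fps"
  assumes "f $ 0 = 0"
  shows "(f ^ l) $ k = (\<Sum>xs\<in>compositions k l. \<Prod>i<l. f $ (xs ! i))"
  using fps_prod_lessThan_nth_compositions[of l "\<lambda>_. f" k] assms by simp

lemma fps_power_nth_eq_0:
  fixes f :: "'a::comm_semiring_1 fps"
  assumes "f $ 0 = 0" "k < l"
  shows "(f ^ l) $ k = 0"
  using fps_prod_lessThan_nth_eq_0[of l "\<lambda>_. f" k] assms by simp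

text \<open>Two nested expansions: first over the l powers, then inside each power. The constraint
  \<open>ks ! i \<ge> r i\<close> appears because the power \<open>f i ^ r i\<close> has no
  coefficients below \<open>r i\<close>.\<close>

lemma fps_prod_power_nth:
  fixes f :: "nat \<Rightarrow> 'a::comm_semiring_1 fps"
  assumes f: "\<And>i. i < l \<Longrightarrow> f i $ 0 = 0" and r: "\<And>i. i < l \<Longrightarrow> r i \<ge> 1"
  shows "(\<Prod>i<l. f i ^ r i) $ k =
    (\<Sum>ks\<in>{ks \<in> compositions k l. \<forall>i<l. ks ! i \<ge> r i}.
      \<Prod>i<l. \<Sum>js\<in>compositions (ks ! i) (r i). \<Prod>t<r i. f i $ (js ! t))"
proof -
  have "(f i ^ r i) $ 0 = 0" if "i < l" for i
    using fps_power_nth_eq_0[OF f[OF that], of 0 "r i"] r[OF that] by simp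
  then have "(\<Prod>i<l. f i ^ r i) $ k = (\<Sum>ks\<in>compositions k l. \<Prod>i<l. (f i ^ r i) $ (ks ! i))"
    by (rule fps_prod_lessThan_nth_compositions)
  also have "\<dots> = (\<Sum>ks\<in>{ks \<in> compositions k l. \<forall>i<l. ks ! i \<ge> r i}. \<Prod>i<l. (f i ^ r i) $ (ks ! i))"
  proof (rule sum.mono_neutral_right)
    show "\<forall>ks\<in>compositions k l - {ks \<in> compositions k l. \<forall>i<l. r i \<le> ks ! i}.
        (\<Prod>i<l. (f i ^ r i) $ (ks ! i)) = 0"
    proof
      fix ks assume "ks \<in> compositions k l - {ks \<in> compositions k l. \<forall>i<l. r i \<le> ks ! i}"
      then obtain i where "i < l" "ks ! i < r i" by (auto simp: not_le)
      then show "(\<Prod>i<l. (f i ^ r i) $ (ks ! i)) = 0"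
        using fps_power_nth_eq_0[OF f] by (intro prod_zero bexI[of _ i]) auto
    qed
  qed (auto simp: finite_compositions)
  also have "\<dots> = (\<Sum>ks\<in>{ks \<in> compositions k l. \<forall>i<l. ks ! i \<ge> r i}.
      \<Prod>i<l. \<Sum>js\<in>compositions (ks ! i) (r i). \<Prod>t<r i. f i $ (js ! t))"
    by (intro sum.cong prod.cong refl) (simp add: fps_power_nth_compositions f)
  finally show ?thesis .
qed

section \<open>Grouping compositions by their multiset of parts\<close>

text \<open>Strictly increasing sizes \<open>ns\<close> with positive multiplicities
  \<open>rs\<close> encode exactly a finite multiset, here the multiset of parts of a
  composition.\<close>

definition blocks :: "nat list \<Rightarrow> nat list \<Rightarrow> nat multiset" where
  "blocks rs ns = (\<Sum>i<length ns. replicate_mset (rs ! i) (ns ! i))"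

lemma count_blocks:
  assumes "distinct ns" "i < length ns"
  shows "count (blocks rs ns) (ns ! i) = rs ! i"
proof -
  have "count (blocks rs ns) (ns ! i) = (\<Sum>j<length ns. if j = i then rs ! j else 0)"
    unfolding blocks_def count_sum using assms
    by (intro sum.cong) (auto simp: nth_eq_iff_index_eq)
  also have "\<dots> = rs ! i" using assms by simp
  finally show ?thesis .
qed

lemma set_mset_blocks:
  assumes "\<And>i. i < length ns \<Longrightarrow> rs ! i \<ge> 1"
  shows "set_mset (blocks rs ns) = set ns"
proof -
  have "count (blocks rs ns) x \<noteq> 0 \<longleftrightarrow> x \<in> set ns" for x
    using assms by (force simp: blocks_def count_sum in_set_conv_nth)
  then show ?thesis by (metis count_eq_zero_iff set_eqI)
qed

lemma size_blocks: "length rs = length ns \<Longrightarrow> size (blocks rs ns) = sum_list rs"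
  by (simp add: blocks_def size_multiset_sum sum_list_sum_nth atLeast0LessThan)

lemma sum_mset_blocks: "sum_mset (blocks rs ns) = (\<Sum>i<length ns. rs ! i * ns ! i)"
proof -
  have "sum_mset (\<Sum>i\<in>A. replicate_mset (rs ! i) (ns ! i)) = (\<Sum>i\<in>A. rs ! i * ns ! i)" if "finite A" for A
    using that by (induction A) (simp_all)
  then show ?thesis by (simp add: blocks_def)
qed

lemma prod_mset_blocks:
  fixes f :: "nat \<Rightarrow> 'a::comm_monoid_mult"
  shows "prod_mset (image_mset f (blocks rs ns)) = (\<Prod>i<length ns. f (ns ! i) ^ rs ! i)"
proof -
  have "prod_mset (image_mset f (\<Sum>i\<in>A. replicate_mset (rs ! i) (ns ! i))) = (\<Prod>i\<in>A. f (ns ! i) ^ rs ! i)"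
    if "finite A" for A
    using that by (induction A) (simp_all)
  then show ?thesis by (simp add: blocks_def)
qed

lemma count_sorted_list_of_set_ge_1:
  fixes M :: "nat multiset"
  assumes "i < length (sorted_list_of_set (set_mset M))"
  shows "map (count M) (sorted_list_of_set (set_mset M)) ! i \<ge> 1"
proof -
  have "sorted_list_of_set (set_mset M) ! i \<in># M"
    using nth_mem[OF assms] by simp
  then show ?thesis
    using assms by (simp add: Suc_le_eq)
qed

text \<open>One half of the bijection between multisets and pairs \<open>rs\<close>,
  \<open>ns\<close>: every multiset is recovered from its sorted distinct elements and their
  multiplicities.\<close>

lemma blocks_sorted_list_of_set:
  defines "ns M \<equiv> sorted_list_of_set (set_mset M)"
  shows "blocks (map (count M) (ns M)) (ns M) = M"
proof (rule multiset_eqI)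
  fix x
  let ?B = "blocks (map (count M) (ns M)) (ns M)"
  show "count ?B x = count M x"
  proof (cases "x \<in># M")
    case True
    then obtain i where "i < length (ns M)" "x = ns M ! i"
      by (metis in_set_conv_nth ns_def finite_set_mset set_sorted_list_of_set)
    then show ?thesis using count_blocks[of "ns M" i] by (simp add: ns_def)
  next
    case False
    have "set_mset ?B = set (ns M)"
      unfolding ns_def by (rule set_mset_blocks) (rule count_sorted_list_of_set_ge_1)
    then have "x \<notin># ?B" using False by (simp add: ns_def)
    then show ?thesis using False by (metis not_in_iff)
  qed
qed

text \<open>As the sizes are distinct, the multiplicities in the multiset are the entries of
  \<open>rs\<close>, so the number of its arrangements is the multinomial coefficient.\<close>

lemma card_permutations_of_blocks:
  assumes "distinct ns" "length rs = length ns" "\<And>i. i < length ns \<Longrightarrow> rs ! i \<ge> 1"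
  shows "card (permutations_of_multiset (blocks rs ns)) = multinomial (sum_list rs) rs"
proof -
  have "map (\<lambda>x. fact (count (blocks rs ns) x)) ns = (map fact rs :: nat list)"
    using assms by (intro nth_equalityI) (auto simp: count_blocks)
  then have "(\<Prod>x\<in>set ns. fact (count (blocks rs ns) x)) = (\<Prod>x\<leftarrow>rs. fact x :: nat)"
    using assms(1) by (simp add: prod.distinct_set_conv_list)
  then show ?thesis
    using assms by (simp add: card_permutations_of_multiset set_mset_blocks size_blocks multinomial_def)
qed

text \<open>The product depends only on the multiset of parts of the composition, and each multiset
  arises from as many compositions as it has arrangements. Multisets are then replaced by their
  encodings as pairs \<open>rs\<close>, \<open>ns\<close>.\<close>

lemma sum_compositions_by_mset:
  fixes f :: "nat \<Rightarrow> 'a::comm_semiring_1"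
  assumes r: "r \<ge> 1"
  shows "(\<Sum>xs\<in>compositions n r. \<Prod>i<r. f (xs ! i)) =
    (\<Sum>l = 1..r. \<Sum>rs\<in>compositions r l. \<Sum>ns\<in>size_lists n rs.
      of_nat (multinomial r rs) * (\<Prod>i<l. f (ns ! i) ^ rs ! i))"
proof -
  define MM where "MM = {M. size M = r \<and> sum_mset M = n \<and> 0 \<notin># M}"
  define I where "I = (SIGMA l:{1..r}. SIGMA rs:compositions r l. size_lists n rs)"
  have mset_comp: "mset xs \<in> MM \<longleftrightarrow> xs \<in> compositions n r" for xs
    by (auto simp: MM_def compositions_def sum_mset_sum_list Suc_le_eq) (metis gr0I)
  have MM_eq: "MM = mset ` compositions n r"
    using mset_comp by (metis (no_types, lifting) ex_mset image_iff set_eqI)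
  have "(\<Sum>xs\<in>compositions n r. \<Prod>i<r. f (xs ! i)) =
      (\<Sum>xs\<in>compositions n r. prod_mset (image_mset f (mset xs)))"
  proof (rule sum.cong)
    fix xs assume "xs \<in> compositions n r"
    then have "length xs = r" by (simp add: compositions_def)
    then have "(\<Prod>i<r. f (xs ! i)) = prod_list (map f xs)"
      by (simp add: prod.list_conv_set_nth atLeast0LessThan)
    also have "\<dots> = prod_mset (image_mset f (mset xs))"
      by (metis mset_map prod_mset_prod_list)
    finally show "(\<Prod>i<r. f (xs ! i)) = prod_mset (image_mset f (mset xs))" .
  qed simp
  also have "\<dots> = (\<Sum>M\<in>MM. \<Sum>xs\<in>{xs \<in> compositions n r. mset xs = M}. prod_mset (image_mset f (mset xs)))"
    unfolding MM_eq by (rule sum.image_gen) (rule finite_compositions)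
  also have "\<dots> = (\<Sum>M\<in>MM. of_nat (card (permutations_of_multiset M)) * prod_mset (image_mset f M))"
  proof (rule sum.cong)
    fix M assume "M \<in> MM"
    then have "{xs \<in> compositions n r. mset xs = M} = permutations_of_multiset M"
      using mset_comp by (auto simp: permutations_of_multiset_def)
    then show "(\<Sum>xs\<in>{xs \<in> compositions n r. mset xs = M}. prod_mset (image_mset f (mset xs))) =
        of_nat (card (permutations_of_multiset M)) * prod_mset (image_mset f M)"
      by (simp add: permutations_of_multiset_def)
  qed simp
  also have "\<dots> = (\<Sum>(l, rs, ns)\<in>I. of_nat (multinomial r rs) * (\<Prod>i<l. f (ns ! i) ^ rs ! i))"
  proof -
    let ?ns = "\<lambda>M :: nat multiset. sorted_list_of_set (set_mset M)"
    let ?w = "\<lambda>M. (card (set_mset M), map (count M) (?ns M), ?ns M)"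
    let ?v = "\<lambda>(l :: nat, rs, ns). blocks rs ns"
    have I: "length rs = l" "length ns = l" "distinct ns" "sorted_wrt (<) ns" "\<And>i. i < l \<Longrightarrow> rs ! i \<ge> 1"
      "\<And>x. x \<in> set ns \<Longrightarrow> x \<ge> 1" "sum_list rs = r" "(\<Sum>i<l. rs ! i * ns ! i) = n"
      if "(l, rs, ns) \<in> I" for l rs ns
      using that by (auto simp: I_def compositions_def size_lists_def strict_sorted_iff)
    show ?thesis
    proof (rule sum.reindex_bij_witness[where i = ?v and j = ?w], goal_cases)
      case (1 M)
      then show ?case by (simp add: blocks_sorted_list_of_set)
    next
      case (2 M)
      have M: "size M = r" "sum_mset M = n" "0 \<notin># M" using 2 by (auto simp: MM_def)
      have len: "length (?ns M) = card (set_mset M)" by simp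
      have "sum_list (map (count M) (?ns M)) = r"
        using size_blocks[of "map (count M) (?ns M)" "?ns M"] M by (simp add: blocks_sorted_list_of_set)
      moreover have "(\<Sum>i<card (set_mset M). map (count M) (?ns M) ! i * ?ns M ! i) = n"
        using sum_mset_blocks[of "map (count M) (?ns M)" "?ns M"] M by (simp add: blocks_sorted_list_of_set)
      \<comment> \<open>Every distinct element has multiplicity at least 1, and the multiplicities
        add up to r.\<close>
      moreover have "card (set_mset M) \<le> r" 
        using M(1) sum_mono[of "set_mset M" "\<lambda>_. 1" "count M"] by (simp add: size_multiset_overloaded_eq Suc_le_eq)
      \<comment> \<open>Here \<open>r \<ge> 1\<close> enters: the multiset is nonempty, so l starts
        at 1.\<close>
      moreover have "card (set_mset M) \<ge> 1" using M(1) r by (auto simp: Suc_le_eq card_gt_0_iff)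
      moreover have "x \<ge> 1" if "x \<in># M" for x using that M(3) by (metis gr0I less_one not_le)
      ultimately show ?case
        by (auto simp: I_def compositions_def size_lists_def Suc_le_eq)
    next
      case (3 x)
      then obtain l rs ns where x: "x = (l, rs, ns)" "(l, rs, ns) \<in> I" by (cases x) auto
      note I = I[OF x(2)]
      have s: "set_mset (blocks rs ns) = set ns" using I by (intro set_mset_blocks) auto
      have "sorted_list_of_set (set ns) = ns"
        using I by (metis sorted_list_of_set.idem_if_sorted_distinct strict_sorted_iff)
      moreover have "map (count (blocks rs ns)) ns = rs"
        using I by (intro nth_equalityI) (auto simp: count_blocks)
      moreover have "card (set ns) = l" using I by (simp add: distinct_card)
      ultimately show ?case by (simp add: x s)
    next
      case (4 x)
      then obtain l rs ns where x: "x = (l, rs, ns)" "(l, rs, ns) \<in> I" by (cases x) auto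
      note I = I[OF x(2)]
      have "set_mset (blocks rs ns) = set ns" using I by (intro set_mset_blocks) auto
      then show ?case using I by (force simp: x MM_def size_blocks sum_mset_blocks)
    next
      case (5 M)
      let ?rs = "map (count M) (?ns M)"
      have "sum_list ?rs = r"
        using size_blocks[of ?rs "?ns M"] 5 by (simp add: blocks_sorted_list_of_set MM_def)
      then have "card (permutations_of_multiset M) = multinomial r ?rs"
        using card_permutations_of_blocks[of "?ns M" ?rs, OF _ _ count_sorted_list_of_set_ge_1]
        by (simp add: blocks_sorted_list_of_set)
      moreover have "prod_mset (image_mset f M) = (\<Prod>i<card (set_mset M). f (?ns M ! i) ^ ?rs ! i)"
        using prod_mset_blocks[of f ?rs "?ns M"] by (simp add: blocks_sorted_list_of_set)
      ultimately show ?case by simp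
    qed
  qed
  also have "\<dots> = (\<Sum>l = 1..r. \<Sum>rs\<in>compositions r l. \<Sum>ns\<in>size_lists n rs.
      of_nat (multinomial r rs) * (\<Prod>i<l. f (ns ! i) ^ rs ! i))"
    unfolding I_def
    by (subst sum.Sigma[symmetric])
      (auto simp: finite_compositions finite_size_lists sum.Sigma[symmetric] intro!: finite_SigmaI)
  finally show ?thesis .
qed

section \<open>Generating functions\<close>

text \<open>The series P of the connected case. The outer variable marks the size and the inner one
  the domination number.\<close>

definition gf_c :: "nat fps fps" where
  "gf_c = Abs_fps (\<lambda>n. Abs_fps (c n))"

definition gf_all :: "nat fps fps" where
  "gf_all = Abs_fps (\<lambda>n. Abs_fps (\<lambda>k. card (perms_dom n k)))"

lemma gf_all_eq: "gf_all = 1 + gf_c * gf_all"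
proof (intro fps_ext)
  fix n k
  have c0: "gf_c $ 0 = 0"
    by (intro fps_ext) (simp add: gf_c_def c_0_left)
  show "gf_all $ n $ k = (1 + gf_c * gf_all) $ n $ k"
  proof (cases "n = 0")
    case True
    then show ?thesis using c0 by (simp add: gf_all_def perms_dom_0)
  next
    case False
    have "(gf_c * gf_all) $ n $ k = (\<Sum>m\<in>{0..n}. (gf_c $ m * gf_all $ (n - m)) $ k)"
      by (simp add: fps_mult_nth fps_sum_nth)
    also have "\<dots> = (\<Sum>m\<in>{1..n}. (gf_c $ m * gf_all $ (n - m)) $ k)"
      by (rule sum.mono_neutral_right) (auto simp: c0 Suc_le_eq)
    also have "\<dots> = (\<Sum>m\<in>{1..n}. \<Sum>j\<le>k. c m j * card (perms_dom (n - m) (k - j)))"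
      by (simp add: fps_mult_nth gf_c_def gf_all_def atLeast0AtMost)
    also have "\<dots> = card (perms_dom n k)"
      using False by (intro card_perms_dom_rec[symmetric]) simp
    finally show ?thesis using False by (simp add: gf_all_def)
  qed
qed

text \<open>The equation T = 1 + P * T iterated N times. The finite form with a remainder avoids
  both subtraction, absent from natural coefficients, and infinite sums.\<close>

lemma gf_all_expand: "gf_all = (\<Sum>r<N. gf_c ^ r) + gf_c ^ N * gf_all"
proof (induction N)
  case (Suc N)
  have "gf_c ^ N * gf_all = gf_c ^ N * (1 + gf_c * gf_all)"
    using gf_all_eq by simp
  also have "\<dots> = gf_c ^ N + gf_c ^ Suc N * gf_all"
    by (simp add: algebra_simps)
  finally have "gf_c ^ N * gf_all = gf_c ^ N + gf_c ^ Suc N * gf_all" .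
  then show ?case using Suc by (simp add: add.assoc)
qed simp

text \<open>Each of the r connected summands contributes at least 1 to the domination number, so r
  cannot exceed k.\<close>

lemma gf_c_power_nth_eq_0:
  assumes "k < r"
  shows "(gf_c ^ r) $ n $ k = 0"
proof -
  have "gf_c $ 0 = 0" by (intro fps_ext) (simp add: gf_c_def c_0_left)
  then have "(gf_c ^ r) $ n $ k = (\<Sum>xs\<in>compositions n r. (\<Prod>i<r. gf_c $ (xs ! i)) $ k)"
    by (simp add: fps_power_nth_compositions fps_sum_nth)
  also have "\<dots> = 0"
    by (intro sum.neutral ballI fps_prod_lessThan_nth_eq_0 assms) (simp add: gf_c_def c_0_right)
  finally show ?thesis .
qed

text \<open>The outer coefficient is grouped by \<open>sum_compositions_by_mset\<close>, the inner
  one expanded by \<open>fps_prod_power_nth\<close>.\<close>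

lemma gf_c_power_nth:
  assumes "r \<ge> 1"
  shows "(gf_c ^ r) $ n $ k =
    (\<Sum>l = 1..r. \<Sum>rs \<in> compositions r l. \<Sum>ns \<in> size_lists n rs.
      \<Sum>ks \<in> {ks \<in> compositions k l. \<forall>i<l. ks ! i \<ge> rs ! i}.
        multinomial r rs *
        (\<Prod>i<l. \<Sum>js \<in> compositions (ks ! i) (rs ! i). \<Prod>t<rs ! i. c (ns ! i) (js ! t)))"
proof -
  have "gf_c $ 0 = 0" by (intro fps_ext) (simp add: gf_c_def c_0_left)
  then have "(gf_c ^ r) $ n = (\<Sum>l = 1..r. \<Sum>rs\<in>compositions r l. \<Sum>ns\<in>size_lists n rs.
      of_nat (multinomial r rs) * (\<Prod>i<l. (gf_c $ (ns ! i)) ^ rs ! i))"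
    using sum_compositions_by_mset[OF assms, of "\<lambda>m. gf_c $ m" n]
    by (simp add: fps_power_nth_compositions)
  then have "(gf_c ^ r) $ n $ k = (\<Sum>l = 1..r. \<Sum>rs\<in>compositions r l. \<Sum>ns\<in>size_lists n rs.
      multinomial r rs * (\<Prod>i<l. (gf_c $ (ns ! i)) ^ rs ! i) $ k)"
    \<comment> \<open>Rewriting the multinomial coefficient as a constant inner series lets it pass
      out of the coefficient extraction.\<close>
    by (simp add: fps_sum_nth flip: fps_of_nat)
  also have "\<dots> = (\<Sum>l = 1..r. \<Sum>rs \<in> compositions r l. \<Sum>ns \<in> size_lists n rs.
      \<Sum>ks \<in> {ks \<in> compositions k l. \<forall>i<l. ks ! i \<ge> rs ! i}.
        multinomial r rs *
        (\<Prod>i<l. \<Sum>js \<in> compositions (ks ! i) (rs ! i). \<Prod>t<rs ! i. c (ns ! i) (js ! t)))"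
  proof (intro sum.cong refl)
    fix l rs ns
    assume rs: "rs \<in> compositions r l"
    have "(\<Prod>i<l. (gf_c $ (ns ! i)) ^ rs ! i) $ k =
        (\<Sum>ks \<in> {ks \<in> compositions k l. \<forall>i<l. ks ! i \<ge> rs ! i}.
          \<Prod>i<l. \<Sum>js \<in> compositions (ks ! i) (rs ! i). \<Prod>t<rs ! i. gf_c $ (ns ! i) $ (js ! t))"
      using compositions_bounds(2)[OF rs]
      by (intro fps_prod_power_nth) (simp_all add: gf_c_def c_0_right)
    then show "multinomial r rs * (\<Prod>i<l. (gf_c $ (ns ! i)) ^ rs ! i) $ k =
        (\<Sum>ks \<in> {ks \<in> compositions k l. \<forall>i<l. ks ! i \<ge> rs ! i}. multinomial r rs *
          (\<Prod>i<l. \<Sum>js \<in> compositions (ks ! i) (rs ! i). \<Prod>t<rs ! i. c (ns ! i) (js ! t)))"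
      by (simp add: sum_distrib_left gf_c_def)
  qed
  finally show ?thesis .
qed

theorem theorem9:
  fixes n k :: nat
  assumes "n \<ge> 1" and "k \<ge> 1"
  shows "d n k =
    (\<Sum>r = 2..k. \<Sum>l = 1..r. \<Sum>rs \<in> compositions r l. \<Sum>ns \<in> size_lists n rs.
      \<Sum>ks \<in> {ks \<in> compositions k l. \<forall>i<l. ks ! i \<ge> rs ! i}.
        multinomial r rs *
        (\<Prod>i<l. \<Sum>js \<in> compositions (ks ! i) (rs ! i). \<Prod>t<rs ! i. c (ns ! i) (js ! t)))"
proof -
  \<comment> \<open>With \<open>N = Suc k\<close> the remainder of \<open>gf_all_expand\<close> has
    no coefficient at inner degree k or below.\<close>
  have "(gf_c ^ Suc k * gf_all) $ n $ k =
      (\<Sum>i = 0..n. \<Sum>j = 0..k. (gf_c ^ Suc k) $ i $ j * gf_all $ (n - i) $ (k - j))"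
    unfolding fps_mult_nth[of "gf_c ^ Suc k"] fps_sum_nth
    by (intro sum.cong refl fps_mult_nth)
  also have "\<dots> = 0"
    by (intro sum.neutral ballI) (simp add: gf_c_power_nth_eq_0 del: power_Suc)
  finally have "(gf_c ^ Suc k * gf_all) $ n $ k = 0" .
  then have "gf_all $ n $ k = (\<Sum>r<Suc k. (gf_c ^ r) $ n $ k)"
    by (subst gf_all_expand[of "Suc k"]) (simp add: fps_sum_nth del: power_Suc sum.lessThan_Suc)
  \<comment> \<open>The term r = 0 vanishes since n is positive, and r = 1 gives
    \<open>c n k\<close>, which cancels against \<open>c_plus_d\<close> and leaves the disconnected
    count.\<close>
  also have "{..<Suc k} = insert 0 (insert 1 {2..k})"
    using assms(2) by auto
  also have "(\<Sum>r\<in>insert 0 (insert 1 {2..k}). (gf_c ^ r) $ n $ k) = c n k + (\<Sum>r = 2..k. (gf_c ^ r) $ n $ k)"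
    using assms(1) by (simp add: gf_c_def)
  finally have "d n k = (\<Sum>r = 2..k. (gf_c ^ r) $ n $ k)"
    using c_plus_d[of n k] by (simp add: gf_all_def)
  also have "\<dots> = (\<Sum>r = 2..k. \<Sum>l = 1..r. \<Sum>rs \<in> compositions r l. \<Sum>ns \<in> size_lists n rs.
      \<Sum>ks \<in> {ks \<in> compositions k l. \<forall>i<l. ks ! i \<ge> rs ! i}.
        multinomial r rs *
        (\<Prod>i<l. \<Sum>js \<in> compositions (ks ! i) (rs ! i). \<Prod>t<rs ! i. c (ns ! i) (js ! t)))"
    by (intro sum.cong refl gf_c_power_nth) simp
  finally show ?thesis .
qed

end
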